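(* For any positive integers $N,M$ with $1\le M\le N$, there exists an $(N,M)$ storage design array $\mathbf P$ whose number of distinct columns is $\eta_{\mathbf P}=\eta\!\left(\frac{N}{\gcd(N,M)},\frac{M}{\gcd(N,M)}\right)$, where $\eta(N,M)$ is defined recursively for all integers $1\le M\le N$ with $\gcd(N,M)=1$ by $$\eta(N,M)=\begin{cases}1,&\text{if }N=1,\\ 1+\eta(N-M,M),&\text{if }N>1\text{ and }N\ge 2M,\\ 1+\eta(M,2M-N),&\text{if }N>1\text{ and }N<2M.\end{cases}$$
   Context: For integers $1\le M\le N$, an $(N,M)$ storage design array (SDA) is an $N\times\frac{N}{\gcd(N,M)}$ array with entries in $\{*,\mathrm{NULL}\}$ such that each column has exactly $M$ entries $*$ and each row has exactly $\frac{M}{\gcd(N,M)}$ entries $*$. For an SDA $\mathbf P$, $\eta_{\mathbf P}$ denotes the number of distinct columns of $\mathbf P$. *)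

theory Defs
  imports Jordan_Normal_Form.Matrix
begin

datatype sda_entry = Star | Null

definition is_sda :: "nat \<Rightarrow> nat \<Rightarrow> sda_entry mat \<Rightarrow> bool" where
  "is_sda N M P \<longleftrightarrow>
     1 \<le> M \<and> M \<le> N \<and>
     P \<in> carrier_mat N (N div gcd N M) \<and>
     (\<forall>j < dim_col P. card {i. i < dim_row P \<and> P $$ (i, j) = Star} = M) \<and>
     (\<forall>i < dim_row P. card {j. j < dim_col P \<and> P $$ (i, j) = Star} = M div gcd N M)"

definition num_distinct_cols :: "'a mat \<Rightarrow> nat" where
  "num_distinct_cols P = card (set (cols P))"

(* The recursion is only meant for coprime 1 \<le> M \<le> N, a domain closed under the recursive
   calls; the value 0 outside it is a dummy. *)
function sda_eta :: "nat \<Rightarrow> nat \<Rightarrow> nat" where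
  "sda_eta N M =
     (if \<not> (1 \<le> M \<and> M \<le> N \<and> coprime N M) then 0
      else if N = 1 then 1
      else if N \<ge> 2 * M then 1 + sda_eta (N - M) M
      else 1 + sda_eta M (2 * M - N))"
  by pat_completeness auto
termination
proof (relation "Wellfounded.measure fst")
  fix N M :: nat
  assume "\<not> \<not> (1 \<le> M \<and> M \<le> N \<and> coprime N M)" "N \<noteq> 1"
  then have "M < N"
    by (metis coprime_self le_neq_implies_less nat_dvd_1_iff_1)
  then show "((M, 2 * M - N), (N, M)) \<in> Wellfounded.measure fst" by simp
qed auto

declare sda_eta.simps [simp del]

lemma sda_eta_one: "sda_eta 1 1 = 1"
  by (simp add: sda_eta.simps)

lemma sda_eta_ge:
  assumes "1 \<le> M" "M \<le> N" "coprime N M" "N > 1" "N \<ge> 2 * M"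
  shows "sda_eta N M = 1 + sda_eta (N - M) M"
  using assms by (subst sda_eta.simps) simp

lemma sda_eta_less:
  assumes "1 \<le> M" "M \<le> N" "coprime N M" "N > 1" "N < 2 * M"
  shows "sda_eta N M = 1 + sda_eta M (2 * M - N)"
  using assms by (subst sda_eta.simps) simp

end

(* A coprime (n, m) array can be chosen symmetric, so only column sums matter. The array for
   (n, m) arises from the smaller array P' of the recursive call as the block array [[P', *], [*, 0]]
   if n < 2m and [[P', 0], [0, *]] if n \<ge> 2m: the columns of the second block column are all equal
   and differ from every other column in the lower block, so exactly one distinct column is added.
   In general, stack gcd(N, M) copies of the reduced array; this keeps equality of columns. *)

theory Submission
  imports Defs
begin

text \<open>Columns are kept as sets of row indices, so the distinct ones are counted by the
  cardinality of an image; matrices enter only in the final theorem.\<close>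

definition rel_col :: "nat \<Rightarrow> (nat \<Rightarrow> nat \<Rightarrow> bool) \<Rightarrow> nat \<Rightarrow> nat set" where
  "rel_col n S j = {i. i < n \<and> S i j}"

text \<open>The flag \<open>c\<close> selects between the two block arrays: it is the entry of the
  off-diagonal blocks, and its negation fills the new diagonal block.\<close>

definition border :: "nat \<Rightarrow> bool \<Rightarrow> (nat \<Rightarrow> nat \<Rightarrow> bool) \<Rightarrow> nat \<Rightarrow> nat \<Rightarrow> bool" where
  "border a c S i j =
     (if i < a \<and> j < a then S i j else if i < a \<or> j < a then c else \<not> c)"

lemma border_sym: "symp S \<Longrightarrow> symp (border a c S)"
  by (auto simp: symp_def border_def)

lemma rel_col_border_old:
  assumes "j < a"
  shows "rel_col (a + b) (border a c S) j = rel_col a S j \<union> (if c then {a..<a + b} else {})"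
  using assms by (auto simp: rel_col_def border_def split: if_splits)

lemma rel_col_border_new:
  assumes "a \<le> j"
  shows "rel_col (a + b) (border a c S) j = (if c then {..<a} else {a..<a + b})"
  using assms by (auto simp: rel_col_def border_def split: if_splits)

lemma rel_col_subset: "rel_col n S j \<subseteq> {..<n}"
  by (auto simp: rel_col_def)

lemma finite_rel_col [simp]: "finite (rel_col n S j)"
  by (simp add: rel_col_def)

lemma card_rel_col_border_old:
  assumes "j < a"
  shows "card (rel_col (a + b) (border a c S) j) = card (rel_col a S j) + (if c then b else 0)"
proof -
  have "rel_col a S j \<inter> {a..<a + b} = {}"
    using rel_col_subset by fastforce
  then show ?thesis
    using assms by (simp add: rel_col_border_old card_Un_disjoint)
qed

lemma card_rel_col_border_new:
  assumes "a \<le> j"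
  shows "card (rel_col (a + b) (border a c S) j) = (if c then a else b)"
  using assms by (simp add: rel_col_border_new)

lemma card_distinct_border:
  assumes "0 < b"
  shows "card (rel_col (a + b) (border a c S) ` {..<a + b}) = Suc (card (rel_col a S ` {..<a}))"
proof -
  define U where "U = (if c then {a..<a + b} else {})"
  define V where "V = (if c then {..<a} else {a..<a + b})"
  let ?C = "rel_col (a + b) (border a c S)"
  have split: "{..<a + b} = {..<a} \<union> {a..<a + b}" by auto
  have old: "?C ` {..<a} = (\<lambda>X. X \<union> U) ` rel_col a S ` {..<a}"
    by (auto simp: rel_col_border_old U_def image_image)
  have "?C ` {a..<a + b} = (\<lambda>_. V) ` {a..<a + b}"
    by (rule image_cong) (simp_all add: rel_col_border_new V_def)
  then have new: "?C ` {a..<a + b} = {V}"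
    using assms by (simp add: image_constant[of a])
  have inj: "inj_on (\<lambda>X. X \<union> U) (rel_col a S ` {..<a})"
  \<comment> \<open>Restricting to the first \<open>a\<close> rows undoes the extension, because
    \<open>U\<close> lies entirely in the new rows.\<close>
  proof (rule inj_on_inverseI[where g = "\<lambda>X. X \<inter> {..<a}"])
    fix X assume "X \<in> rel_col a S ` {..<a}"
    then have "X \<subseteq> {..<a}" using rel_col_subset by blast
    then show "(X \<union> U) \<inter> {..<a} = X" by (auto simp: U_def)
  qed
  \<comment> \<open>Row \<open>a\<close>, the first new one, exists since \<open>0 < b\<close>;
    there old columns have entry \<open>c\<close> and new ones the opposite.\<close>
  have "a \<in> V \<longleftrightarrow> a \<notin> X" if "X \<in> ?C ` {..<a}" for X
  proof -
    obtain j where "X = rel_col a S j \<union> U" using \<open>X \<in> _\<close> unfolding old by blast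
    moreover have "a \<notin> rel_col a S j" by (simp add: rel_col_def)
    ultimately show ?thesis using assms by (auto simp: U_def V_def)
  qed
  then have "V \<notin> ?C ` {..<a}" by blast
  then have "card (?C ` {..<a + b}) = Suc (card (?C ` {..<a}))"
    unfolding split image_Un new by simp
  then show ?thesis unfolding old by (simp add: card_image[OF inj])
qed

text \<open>Common step of both branches of the recursion: the two equations make the sums of old
  and new columns agree.\<close>

lemma symmetric_design_border:
  assumes "symp S" "\<forall>j<a. card (rel_col a S j) = r" "0 < b"
    and "r + (if c then b else 0) = m" "(if c then a else b) = m"
  shows "\<exists>T. symp T \<and> (\<forall>j<a + b. card (rel_col (a + b) T j) = m)
           \<and> card (rel_col (a + b) T ` {..<a + b}) = Suc (card (rel_col a S ` {..<a}))"
proof (intro exI[of _ "border a c S"] conjI allI impI)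
  show "card (rel_col (a + b) (border a c S) j) = m" for j
    using assms by (cases "j < a") (auto simp: card_rel_col_border_old card_rel_col_border_new)
qed (use assms in \<open>simp_all add: border_sym card_distinct_border\<close>)

lemma ex_symmetric_design:
  assumes "1 \<le> m" "m \<le> n" "coprime n m"
  shows "\<exists>S. symp S \<and> (\<forall>j<n. card (rel_col n S j) = m)
           \<and> card (rel_col n S ` {..<n}) = sda_eta n m"
  using assms
proof (induction n arbitrary: m rule: less_induct)
  case (less n)
  consider "n = 1" | "n > 1" "2 * m \<le> n" | "n > 1" "n < 2 * m"
    using less.prems by linarith
  then show ?case
  proof cases
    case 1
    then have "m = 1" using less.prems by simp
    have "{i. i < Suc 0} = {0}" by auto
    then show ?thesis
      using 1 \<open>m = 1\<close>
      by (intro exI[of _ "\<lambda>_ _. True"]) (simp add: rel_col_def sda_eta_one[unfolded One_nat_def] lessThan_Suc symp_def)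
  next
    case 2
    have "m \<le> n - m" using 2 by simp
    have "coprime (n - m) m"
      using less.prems by (simp add: coprime_iff_gcd_eq_1 gcd_diff1_nat)
    then obtain S where S: "symp S" "\<forall>j<n - m. card (rel_col (n - m) S j) = m"
      "card (rel_col (n - m) S ` {..<n - m}) = sda_eta (n - m) m"
      using less.IH[of "n - m" m] less.prems(1) \<open>m \<le> n - m\<close> \<open>n > 1\<close> by auto
    \<comment> \<open>Old columns gain no star and keep sum \<open>m\<close>; each of the
      \<open>m\<close> new columns has its stars in the \<open>m\<close> new rows.\<close>
    then show ?thesis
      using symmetric_design_border[of S "n - m" m m False m] less.prems 2
      by (simp add: sda_eta_ge)
  next
    case 3
    \<comment> \<open>Coprimality excludes \<open>m = n\<close> for \<open>n > 1\<close>, so the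
      recursive size \<open>m\<close> really decreases.\<close>
    have "m < n"
      using less.prems 3 by (metis coprime_self le_neq_implies_less nat_dvd_1_iff_1)
    have "gcd (n - m) m = 1"
      using less.prems by (simp add: gcd_diff1_nat)
    \<comment> \<open>Two subtractive Euclidean steps carry coprimality from \<open>(n, m)\<close>
      to \<open>(m, 2 * m - n)\<close>.\<close>
    moreover have "2 * m - n = m - (n - m)" "n - m \<le> m" using \<open>m < n\<close> 3 by auto
    ultimately have "coprime m (2 * m - n)"
      by (simp only: coprime_iff_gcd_eq_1 gcd.commute[of m] gcd_diff2_nat)
    moreover have "1 \<le> 2 * m - n" "2 * m - n \<le> m" using \<open>m < n\<close> 3 by auto
    ultimately obtain S where S: "symp S" "\<forall>j<m. card (rel_col m S j) = 2 * m - n"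
      "card (rel_col m S ` {..<m}) = sda_eta m (2 * m - n)"
      using less.IH[of m "2 * m - n"] \<open>m < n\<close> by auto
    \<comment> \<open>Old columns gain \<open>n - m\<close> stars, giving
      \<open>(2 * m - n) + (n - m) = m\<close>; new columns have stars exactly in the
      \<open>m\<close> old rows.\<close>
    then show ?thesis
      using symmetric_design_border[of S m "2 * m - n" "n - m" True m] less.prems 3 \<open>m < n\<close>
      by (simp add: sda_eta_less)
  qed
qed

text \<open>Division with remainder splits a row of the stacked array into the index of its copy and
  its row within that copy.\<close>

lemma card_mod_preimage:
  fixes n :: nat
  assumes "A \<subseteq> {..<n}"
  shows "card {i. i < g * n \<and> i mod n \<in> A} = g * card A"
proof -
  have "bij_betw (\<lambda>(k, i). k * n + i) ({..<g} \<times> A) {i. i < g * n \<and> i mod n \<in> A}"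
  proof (rule bij_betw_byWitness[where f' = "\<lambda>i. (i div n, i mod n)"])
    show "(\<lambda>(k, i). k * n + i) ` ({..<g} \<times> A) \<subseteq> {i. i < g * n \<and> i mod n \<in> A}"
    proof clarsimp
      fix k i assume *: "k < g" "i \<in> A"
      then have "i < n" using assms by auto
      have "k * n + i < Suc k * n" using \<open>i < n\<close> by simp
      also have "\<dots> \<le> g * n" using * by (intro mult_le_mono1) simp
      finally show "k * n + i < g * n \<and> i mod n \<in> A" using * \<open>i < n\<close> by simp
    qed
  qed (use assms in \<open>auto simp: less_mult_imp_div_less\<close>)
  from bij_betw_same_card[OF this] show ?thesis by (simp add: card_cartesian_product)
qed

theorem theorem6:
  fixes N M :: nat
  assumes "1 \<le> M" and "M \<le> N"
  shows "\<exists>P. is_sda N M P \<and>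
           num_distinct_cols P = sda_eta (N div gcd N M) (M div gcd N M)"
proof -
  define g n m where "g = gcd N M" and "n = N div g" and "m = M div g"
  have N: "N = g * n" and M: "M = g * m" by (simp_all add: g_def n_def m_def)
  have "g > 0" using assms by (simp add: g_def)
  have "1 \<le> m" "m \<le> n" using assms \<open>g > 0\<close> unfolding N M by auto
  moreover have "coprime n m"
    using assms unfolding n_def m_def g_def by (intro div_gcd_coprime) simp
  ultimately obtain S where S: "symp S" "\<forall>j<n. card (rel_col n S j) = m"
    "card (rel_col n S ` {..<n}) = sda_eta n m"
    using ex_symmetric_design by blast
  have sym: "S i j = S j i" for i j
    using S(1) by (blast dest: sympD)
  have n: "0 < n" using \<open>1 \<le> m\<close> \<open>m \<le> n\<close> by simp
  \<comment> \<open>\<open>F\<close> turns a set of rows into the column made of \<open>g\<close>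
    stacked copies of its indicator.\<close>
  define F where "F X = vec (g * n) (\<lambda>i. if i mod n \<in> X then Star else Null)" for X
  define P where "P = mat (g * n) n (\<lambda>(i, j). if S (i mod n) j then Star else Null)"
  have mem: "i mod n \<in> rel_col n S j \<longleftrightarrow> S (i mod n) j" for i j
    using n by (simp add: rel_col_def)
  have dims: "dim_row P = g * n" "dim_col P = n" by (simp_all add: P_def)
  have "card {i. i < g * n \<and> P $$ (i, j) = Star} = g * m" if "j < n" for j
  proof -
    have "{i. i < g * n \<and> P $$ (i, j) = Star} = {i. i < g * n \<and> i mod n \<in> rel_col n S j}"
      using that by (auto simp: P_def mem split: if_splits)
    then show ?thesis using card_mod_preimage[OF rel_col_subset] S(2) that by simp
  qed
  moreover have "card {j. j < n \<and> P $$ (i, j) = Star} = m" if "i < g * n" for i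
  proof -
    \<comment> \<open>By symmetry, row \<open>i mod n\<close> of \<open>S\<close> is also a column,
      so the column sums give the row sums.\<close>
    have "{j. j < n \<and> P $$ (i, j) = Star} = rel_col n S (i mod n)"
      using that sym by (auto simp: P_def rel_col_def split: if_splits)
    then show ?thesis using S(2) n by simp
  qed
  ultimately have "is_sda N M P"
    using assms unfolding is_sda_def dims g_def[symmetric] n_def[symmetric] m_def[symmetric]
    by (simp add: P_def N M)
  moreover have "num_distinct_cols P = sda_eta n m"
  proof -
    have "col P j = F (rel_col n S j)" if "j < n" for j
      using that by (intro eq_vecI) (auto simp: P_def F_def mem)
    then have "set (cols P) = F ` rel_col n S ` {..<n}"
      by (auto simp: cols_def dims image_image atLeast0LessThan)
    moreover have "inj_on F (Pow {..<n})"
    proof (rule inj_onI)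
      fix X Y assume XY: "X \<in> Pow {..<n}" "Y \<in> Pow {..<n}" and eq: "F X = F Y"
      have "i \<in> X \<longleftrightarrow> i \<in> Y" if "i < n" for i
      proof -
        \<comment> \<open>As \<open>g > 0\<close>, the stack contains a complete first copy, whose
          entries recover \<open>X\<close>.\<close>
        have "n \<le> g * n" using \<open>g > 0\<close> by simp
        then have "i < g * n" using that by linarith
        then show ?thesis
          using arg_cong[OF eq, of "\<lambda>v. v $ i"] that by (auto simp: F_def split: if_splits)
      qed
      then show "X = Y" using XY by auto
    qed
    then have "inj_on F (rel_col n S ` {..<n})"
      by (rule inj_on_subset) (use rel_col_subset in blast)
    ultimately show ?thesis by (simp add: num_distinct_cols_def card_image S(3))
  qed
  ultimately show ?thesis unfolding n_def m_def g_def by blast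
qed

end
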